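(* Let $G$ be a finite simple graph without isolated vertices with minimum degree $\delta(G)=2$ and maximum degree $\Delta(G)$. Then $C_{tr}(G)\le 2\Delta(G)$.
   Context: A set $S\subseteq V$ is a total restrained dominating set (TRD-set) of $G=(V,E)$ if every vertex of $V\setminus S$ is adjacent to at least one vertex of $S$ and to at least one other vertex of $V\setminus S$, and every vertex of $S$ is adjacent to at least one other vertex of $S$. Two disjoint sets $X,Y\subseteq V$ form a total restrained coalition if neither is a TRD-set but $X\cup Y$ is a TRD-set. A trc-partition of $G$ is a partition $\Phi$ of $V$ such that no member of $\Phi$ is a TRD-set and each member forms a total restrained coalition with some other member of $\Phi$. $C_{tr}(G)$ is the maximum cardinality of a trc-partition of $G$. *)

theory Defs
  imports Complex_Main "Graph_Theory.Pair_Digraph" "HOL-Library.Disjoint_Sets"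
begin

(* A finite simple graph is an instance of the locale pair_graph: a finite, loop-free digraph
   with a symmetric arc relation and no parallel arcs.  An edge {u, v} is the pair of arcs
   (u, v), (v, u), so the degree of v is its out-degree, and u \<rightarrow>\<^bsub>G\<^esub> v is adjacency.
   By loop-freeness, "another" vertex in the textbook definitions needs no separate clause. *)

definition no_isolated_vertices :: "'a pair_pre_digraph \<Rightarrow> bool" where
  "no_isolated_vertices G \<longleftrightarrow> (\<forall>v \<in> pverts G. \<exists>u \<in> pverts G. v \<rightarrow>\<^bsub>G\<^esub> u)"

(* The two extremal degrees are meaningful for finite graphs with at least one vertex. *)

definition min_degree :: "'a pair_pre_digraph \<Rightarrow> nat" where
  "min_degree G = Min (out_degree G ` pverts G)"

definition max_degree :: "'a pair_pre_digraph \<Rightarrow> nat" where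
  "max_degree G = Max (out_degree G ` pverts G)"

definition TRD_set :: "'a pair_pre_digraph \<Rightarrow> 'a set \<Rightarrow> bool" where
  "TRD_set G S \<longleftrightarrow>
     S \<subseteq> pverts G \<and>
     (\<forall>v \<in> pverts G - S. (\<exists>u \<in> S. v \<rightarrow>\<^bsub>G\<^esub> u) \<and> (\<exists>w \<in> pverts G - S. v \<rightarrow>\<^bsub>G\<^esub> w)) \<and>
     (\<forall>v \<in> S. \<exists>u \<in> S. v \<rightarrow>\<^bsub>G\<^esub> u)"

definition total_restrained_coalition :: "'a pair_pre_digraph \<Rightarrow> 'a set \<Rightarrow> 'a set \<Rightarrow> bool" where
  "total_restrained_coalition G X Y \<longleftrightarrow>
     X \<subseteq> pverts G \<and> Y \<subseteq> pverts G \<and> X \<inter> Y = {} \<and>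
     \<not> TRD_set G X \<and> \<not> TRD_set G Y \<and> TRD_set G (X \<union> Y)"

definition trc_partition :: "'a pair_pre_digraph \<Rightarrow> 'a set set \<Rightarrow> bool" where
  "trc_partition G \<Phi> \<longleftrightarrow>
     partition_on (pverts G) \<Phi> \<and>
     (\<forall>X \<in> \<Phi>. \<not> TRD_set G X \<and> (\<exists>Y \<in> \<Phi> - {X}. total_restrained_coalition G X Y))"

(* Convention: the value is 0 if G has no trc-partition.  A finite G has finitely many
   partitions, so otherwise this is a genuine maximum. *)

definition C_tr :: "'a pair_pre_digraph \<Rightarrow> nat" where
  "C_tr G =
     (if \<exists>\<Phi>. trc_partition G \<Phi> then Max {card \<Phi> | \<Phi>. trc_partition G \<Phi>} else 0)"

end

(* Every TRD-set meets the neighbourhood of every vertex. A member A of a trc-partition is not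
   TRD, so either it misses some neighbourhood N(v), and then all its coalition partners meet N(v),
   which leaves at most \<Delta> of them; or some v outside A has all its neighbours in A, and then the
   only possible partner is the member containing v.

   Let x have degree 2, with neighbours in the members Y and Z.  Every coalition involves Y or Z, so
   the partition consists of Y, Z and their partners.  If Y = Z there are at most 1 + \<Delta> members.
   If Y and Z are partners there are at most 2\<Delta>.  Otherwise it is enough that both Y and Z have
   fewer than \<Delta> partners, or that together they have at most \<Delta>.  Suppose that Y misses N(v).
   If Z meets N(v), one of the at most \<Delta> members meeting N(v) is not a partner of Y; if Z misses
   N(v) too, the partners of Y and those of Z are all among these members. *)
theory Submission
  imports Defs
begin

text \<open>Choosing one point of \<open>W \<inter> N\<close> for each such member \<open>W\<close>
  is injective, because distinct members are disjoint.\<close>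

lemma card_members_meeting_le:
  assumes "partition_on V \<Phi>" "finite N"
  shows "finite {W \<in> \<Phi>. W \<inter> N \<noteq> {}}" "card {W \<in> \<Phi>. W \<inter> N \<noteq> {}} \<le> card N"
proof -
  let ?P = "{W \<in> \<Phi>. W \<inter> N \<noteq> {}}"
  define f where "f W = (SOME u. u \<in> W \<inter> N)" for W
  have f: "f W \<in> W \<inter> N" if "W \<in> ?P" for W
    unfolding f_def by (rule someI_ex) (use that in blast)
  have "inj_on f ?P"
  proof (rule inj_onI)
    fix W W' assume WW': "W \<in> ?P" "W' \<in> ?P" "f W = f W'"
    then have "f W \<in> W \<inter> W'" using f[OF WW'(1)] f[OF WW'(2)] by simp
    then show "W = W'"
      using WW' disjointD[OF partition_onD2[OF assms(1)], of W W'] by blast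
  qed
  moreover have "f ` ?P \<subseteq> N" using f by blast
  ultimately show "finite ?P" "card ?P \<le> card N"
    using assms(2) by (blast intro: inj_on_finite, blast intro: card_inj_on_le)
qed

definition neighbours :: "'a pair_pre_digraph \<Rightarrow> 'a \<Rightarrow> 'a set" where
  "neighbours G v = {u. v \<rightarrow>\<^bsub>G\<^esub> u}"

definition partners :: "'a pair_pre_digraph \<Rightarrow> 'a set set \<Rightarrow> 'a set \<Rightarrow> 'a set set" where
  "partners G \<Phi> X = {W \<in> \<Phi>. total_restrained_coalition G X W}"

lemma partners_sym:
  "Y \<in> \<Phi> \<Longrightarrow> X \<in> partners G \<Phi> Y \<Longrightarrow> Y \<in> partners G \<Phi> X"
  unfolding partners_def total_restrained_coalition_def by (auto simp: Un_commute)

lemma TRD_set_meets_neighbours: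
  "TRD_set G S \<Longrightarrow> v \<in> pverts G \<Longrightarrow> S \<inter> neighbours G v \<noteq> {}"
  unfolding TRD_set_def neighbours_def by blast

lemma partner_meets_neighbours:
  assumes "W \<in> partners G \<Phi> X" "v \<in> pverts G" "X \<inter> neighbours G v = {}"
  shows "W \<inter> neighbours G v \<noteq> {}"
  using assms TRD_set_meets_neighbours[of G "X \<union> W" v]
  unfolding partners_def total_restrained_coalition_def by blast

context pair_graph
begin

lemma neighbours_eq_image: "neighbours G v = snd ` out_arcs G v"
  by (force simp: neighbours_def out_arcs_def)

lemma finite_neighbours: "finite (neighbours G v)"
  by (rule finite_subset[of _ "snd ` parcs G"])
    (auto simp: neighbours_eq_image out_arcs_def)

lemma card_neighbours: "card (neighbours G v) = out_degree G v"
proof -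
  \<comment> \<open>All arcs out of \<open>v\<close> share the tail \<open>v\<close>, so the head
    determines the arc.\<close>
  have "inj_on snd (out_arcs G v)"
    by (auto simp: inj_on_def out_arcs_def)
  then show ?thesis
    unfolding neighbours_eq_image out_degree_def by (rule card_image)
qed

lemma card_neighbours_le_max_degree: "v \<in> pverts G \<Longrightarrow> card (neighbours G v) \<le> max_degree G"
  unfolding card_neighbours max_degree_def by simp

text \<open>A non-TRD set that meets every neighbourhood can only violate the restrained condition,
  at some outer vertex; every TRD-set containing \<open>X\<close> must then absorb that
  vertex.\<close>

lemma partners_not_TRD:
  assumes "partition_on (pverts G) \<Phi>" "X \<in> \<Phi>" "\<not> TRD_set G X"
  obtains v where "v \<in> pverts G" "X \<inter> neighbours G v = {}"
  | "finite (partners G \<Phi> X)" "card (partners G \<Phi> X) \<le> 1"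
proof (cases "\<forall>v \<in> pverts G. X \<inter> neighbours G v \<noteq> {}")
  case True
  have XV: "X \<subseteq> pverts G" using assms partition_onD1 by blast
  have dom: "\<exists>u \<in> X. v \<rightarrow>\<^bsub>G\<^esub> u" if "v \<in> pverts G" for v
    using True that unfolding neighbours_def by blast
  obtain v where v: "v \<in> pverts G - X" "\<not> (\<exists>w \<in> pverts G - X. v \<rightarrow>\<^bsub>G\<^esub> w)"
    using assms(3) XV dom unfolding TRD_set_def by blast
  \<comment> \<open>Written as the members meeting \<open>{v}\<close>, so that the counting lemma
    gives the bound 1.\<close>
  let ?P = "{W \<in> \<Phi>. W \<inter> {v} \<noteq> {}}"
  have sub: "partners G \<Phi> X \<subseteq> ?P"
  proof
    fix W assume "W \<in> partners G \<Phi> X"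
    then have W: "W \<in> \<Phi>" "TRD_set G (X \<union> W)"
      unfolding partners_def total_restrained_coalition_def by simp_all
    have "v \<in> X \<union> W"
    proof (rule ccontr)
      assume "v \<notin> X \<union> W"
      then obtain w where "w \<in> pverts G - (X \<union> W)" "v \<rightarrow>\<^bsub>G\<^esub> w"
        using v(1) W(2) unfolding TRD_set_def by blast
      then show False using v(2) by blast
    qed
    then show "W \<in> ?P" using v(1) W(1) by blast
  qed
  have fin: "finite ?P" and "card ?P \<le> 1"
    using card_members_meeting_le[OF assms(1), of "{v}"] by simp_all
  with card_mono[OF fin sub] have "card (partners G \<Phi> X) \<le> 1" by linarith
  then show ?thesis using that(2) finite_subset[OF sub fin] by blast
qed (use that in blast)

lemma card_partners_le_max_degree:
  assumes "partition_on (pverts G) \<Phi>" "X \<in> \<Phi>" "\<not> TRD_set G X" "1 \<le> max_degree G"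
  shows "card (partners G \<Phi> X) \<le> max_degree G"
  using assms(1-3)
proof (cases rule: partners_not_TRD)
  case (1 v)
  let ?P = "{W \<in> \<Phi>. W \<inter> neighbours G v \<noteq> {}}"
  have "partners G \<Phi> X \<subseteq> ?P"
    using partner_meets_neighbours[OF _ 1] unfolding partners_def by blast
  then have "card (partners G \<Phi> X) \<le> card ?P"
    by (rule card_mono[OF card_members_meeting_le(1)[OF assms(1) finite_neighbours]])
  then show ?thesis
    using card_members_meeting_le(2)[OF assms(1) finite_neighbours]
      card_neighbours_le_max_degree[OF 1(1)] by (meson order_trans)
qed (use assms(4) in linarith)

text \<open>This saves one on the bound for the partners of \<open>Y\<close>, or else bounds both
  families jointly. The saving pays for \<open>Y\<close> and \<open>Z\<close>, which have to be
  counted separately when they are not partners.\<close>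

lemma card_partners_nonpartner:
  assumes "partition_on (pverts G) \<Phi>" "Y \<in> \<Phi>" "Z \<in> \<Phi>" "\<not> TRD_set G Y" "2 \<le> max_degree G"
    and "Z \<notin> partners G \<Phi> Y"
  shows "card (partners G \<Phi> Y) < max_degree G \<or>
    card (partners G \<Phi> Y \<union> partners G \<Phi> Z) \<le> max_degree G"
  using assms(1,2,4)
proof (cases rule: partners_not_TRD)
  case (1 v)
  let ?P = "{W \<in> \<Phi>. W \<inter> neighbours G v \<noteq> {}}"
  have fin: "finite ?P" and card: "card ?P \<le> max_degree G"
    using card_members_meeting_le[OF assms(1) finite_neighbours]
      card_neighbours_le_max_degree[OF 1(1)] by (blast, meson order_trans)
  have Y: "partners G \<Phi> Y \<subseteq> ?P"
    using partner_meets_neighbours[OF _ 1] unfolding partners_def by blast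
  show ?thesis
  proof (cases "Z \<in> ?P")
    case True
    \<comment> \<open>\<open>Z\<close> itself witnesses strictness.\<close>
    then have "partners G \<Phi> Y \<subset> ?P" using Y assms(6) by blast
    then show ?thesis using psubset_card_mono[OF fin] card by (meson order_less_le_trans)
  next
    case False
    then have "Z \<inter> neighbours G v = {}" using assms(3) by blast
    then have "partners G \<Phi> Z \<subseteq> ?P"
      using partner_meets_neighbours[OF _ 1(1)] unfolding partners_def by blast
    then show ?thesis using Y card_mono[OF fin] card by (meson Un_least order_trans)
  qed
qed (use assms(5) in linarith)

text \<open>The union of a coalition meets \<open>neighbours G x\<close>, hence \<open>Y\<close> or
  \<open>Z\<close>; as members are disjoint, one of the two coalition members is \<open>Y\<close> or
  \<open>Z\<close>.\<close>

lemma partition_subset_partners: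
  assumes "trc_partition G \<Phi>" "x \<in> pverts G" "neighbours G x \<subseteq> Y \<union> Z" "Y \<in> \<Phi>" "Z \<in> \<Phi>"
  shows "\<Phi> \<subseteq> insert Y (insert Z (partners G \<Phi> Y \<union> partners G \<Phi> Z))"
proof
  fix W assume W: "W \<in> \<Phi>"
  then obtain W' where W': "W' \<in> \<Phi>" "total_restrained_coalition G W W'"
    using assms(1) unfolding trc_partition_def by blast
  have dis: "disjoint \<Phi>" using assms(1) partition_onD2 unfolding trc_partition_def by blast
  have "(W \<union> W') \<inter> neighbours G x \<noteq> {}"
    using W' TRD_set_meets_neighbours[OF _ assms(2)]
    unfolding total_restrained_coalition_def by blast
  then have "W \<inter> Y \<noteq> {} \<or> W \<inter> Z \<noteq> {} \<or> W' \<inter> Y \<noteq> {} \<or> W' \<inter> Z \<noteq> {}"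
    using assms(3) by blast
  then have "W = Y \<or> W = Z \<or> W' = Y \<or> W' = Z"
    using disjointD[OF dis] W W'(1) assms(4,5) by metis
  moreover have "W \<in> partners G \<Phi> W'"
    using partners_sym[OF W, of W'] W' unfolding partners_def by blast
  ultimately show "W \<in> insert Y (insert Z (partners G \<Phi> Y \<union> partners G \<Phi> Z))" by blast
qed

lemma card_trc_partition_le:
  assumes trc: "trc_partition G \<Phi>" and x: "x \<in> pverts G" "out_degree G x = 2"
  shows "card \<Phi> \<le> 2 * max_degree G"
proof -
  let ?\<Delta> = "max_degree G" and ?p = "partners G \<Phi>"
  have part: "partition_on (pverts G) \<Phi>" and nTRD: "\<And>X. X \<in> \<Phi> \<Longrightarrow> \<not> TRD_set G X"
    using trc unfolding trc_partition_def by auto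
  have "finite \<Phi>" by (rule finite_elements[OF _ part]) simp
  then have fin: "finite (?p X)" for X unfolding partners_def by simp
  have \<Delta>: "2 \<le> ?\<Delta>" using card_neighbours_le_max_degree[OF x(1)] x(2) card_neighbours by simp
  obtain y z where yz: "neighbours G x = {y, z}"
    using x(2) card_neighbours[of x] card_2_iff by metis
  then have "y \<in> pverts G" "z \<in> pverts G"
    unfolding neighbours_def using adj_in_verts(2)[of x] by auto
  then obtain Y Z where YZ: "Y \<in> \<Phi>" "y \<in> Y" "Z \<in> \<Phi>" "z \<in> Z"
    using partition_onD1[OF part] by blast
  have "neighbours G x \<subseteq> Y \<union> Z" using YZ by (simp add: yz)
  note cover = partition_subset_partners[OF trc x(1) this YZ(1,3)]
  have le: "card (?p Y) \<le> ?\<Delta>" "card (?p Z) \<le> ?\<Delta>"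
    using card_partners_le_max_degree[OF part] YZ nTRD \<Delta> by auto
  have un: "card (?p Y \<union> ?p Z) \<le> card (?p Y) + card (?p Z)" by (rule card_Un_le)
  consider "Y = Z" | "Z \<in> ?p Y" | "Y \<noteq> Z" "Z \<notin> ?p Y" by blast
  then show ?thesis
  proof cases
    case 1
    then have "card \<Phi> \<le> card (insert Y (?p Y))" using cover fin by (auto intro: card_mono)
    also have "\<dots> \<le> Suc (card (?p Y))" by (rule card_insert_le_m1) auto
    finally show ?thesis using le \<Delta> by linarith
  next
    case 2
    then have "Y \<in> ?p Z" using partners_sym[OF YZ(1)] by blast
    \<comment> \<open>\<open>Y\<close> and \<open>Z\<close> are already counted as partners of each
      other.\<close>
    with 2 have "\<Phi> \<subseteq> ?p Y \<union> ?p Z" using cover by blast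
    then have "card \<Phi> \<le> card (?p Y \<union> ?p Z)" using fin by (auto intro: card_mono)
    then show ?thesis using un le by linarith
  next
    case 3
    then have "Y \<notin> ?p Z" using partners_sym[OF YZ(3)] by blast
    \<comment> \<open>The lemma saves only on the partners of its first member, so it is applied in
      both orders.\<close>
    then have "card (?p Z) < ?\<Delta> \<or> card (?p Y \<union> ?p Z) \<le> ?\<Delta>"
      using card_partners_nonpartner[OF part YZ(3,1) nTRD[OF YZ(3)] \<Delta>] by (simp add: Un_commute)
    moreover have "card (?p Y) < ?\<Delta> \<or> card (?p Y \<union> ?p Z) \<le> ?\<Delta>"
      using card_partners_nonpartner[OF part YZ(1,3) nTRD[OF YZ(1)] \<Delta>] 3 by blast
    \<comment> \<open>Two strict bounds add up to at most \<open>2 * ?\<Delta> - 2\<close>; the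
      joint bound \<open>?\<Delta>\<close> is no larger than that because
      \<open>2 \<le> ?\<Delta>\<close>.\<close>
    ultimately have "card (?p Y \<union> ?p Z) + 2 \<le> 2 * ?\<Delta>" using un \<Delta> by linarith
    moreover have "card \<Phi> \<le> card (insert Y (insert Z (?p Y \<union> ?p Z)))"
      using cover fin by (auto intro: card_mono)
    moreover have "\<dots> \<le> card (?p Y \<union> ?p Z) + 2"
      using fin by (simp add: card_insert_if)
    ultimately show ?thesis by linarith
  qed
qed

end

theorem theorem2p13:
  fixes G :: "'a pair_pre_digraph"
  assumes "pair_graph G"
    and "pverts G \<noteq> {}"
    and "no_isolated_vertices G"
    and "min_degree G = 2"
  shows "C_tr G \<le> 2 * max_degree G"
proof (cases "\<exists>\<Phi>. trc_partition G \<Phi>")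
  case True
  interpret pair_graph G by fact
  have "min_degree G \<in> out_degree G ` pverts G"
    unfolding min_degree_def by (rule Min_in) (use assms(2) in auto)
  then obtain x where x: "x \<in> pverts G" "out_degree G x = 2"
    using assms(4) by auto
  let ?C = "{card \<Phi> | \<Phi>. trc_partition G \<Phi>}"
  have bound: "\<And>n. n \<in> ?C \<Longrightarrow> n \<le> 2 * max_degree G"
    using card_trc_partition_le[OF _ x] by blast
  \<comment> \<open>Finiteness makes \<open>Max ?C\<close> an attained value, to which the bound
    applies.\<close>
  then have "finite ?C" by (meson finite_nat_set_iff_bounded_le)
  then have "Max ?C \<in> ?C" by (rule Max_in) (use True in blast)
  then show ?thesis using bound True unfolding C_tr_def by presburger
qed (simp add: C_tr_def)

end
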